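(* The column and constraint generation (C\&CG) algorithm described in the context converges in a finite number of steps, where the maximum possible number of steps is at most as large as the maximum possible number of steps for the dual algorithm (the CG algorithm described in the context). The convergence proof is analogous to the one for the CG algorithm, with the only difference that the constraints only correspond to $p$-values of the vertices of the polyhedron $S$ that defines the feasible region of the subproblem. As multiple vertices might share the same $p$-value, this number can be significantly smaller than the number of constraints that are required in the dual algorithm.
   Context: **Data.** Let $n_x,n_p,n_y,n_d,n_f,n_h\in\mathbb N$, $c\in\mathbb R^{n_x}$, $d\in\mathbb R^{n_d}$, $f\in\mathbb R^{n_f}$, $h\in\mathbb R^{n_h}$, $A\in\mathbb R^{n_p\times n_y}$, $B\in\mathbb R^{n_d\times n_x}$, $C\in\mathbb R^{n_d\times n_y}$, $E\in\mathbb R^{n_f\times n_p}$, $G\in\mathbb R^{n_h\times n_x}$. Vector inequalities are componentwise. **Problem $(P)$** (minimax regret problem): $$\min_x\max_p\min_y\ c^Tx+p^TAy-\min_{x^*,y^*}(c^Tx^*+p^TAy^* )$$ subject to $Bx+Cy\ge d$, $Bx^*+Cy^*\ge d$, $Ep\ge f$, $Gx\ge h$, $x,p,y,x^*,y^*\ge0$, with $x,x^*\in\mathbb R^{n_x}$, $p\in\mathbb R^{n_p}$, $y,y^*\in\mathbb R^{n_y}$. It is reformulated as $$\min_x\max_{p,x^*,y^*}\min_y\ c^Tx+p^TAy-c^Tx^*-p^TAy^*$$ subject to the same constraints. The minimization over $x$ is the first stage, the maximization is the middle stage, and the minimization over $y$ is the second stage. **Relatively complete recourse** (standing assumption): for every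 first and middle stage decision there is a feasible second stage decision. Dualizing the second stage problem (dual variable $\pi\in\mathbb R^{n_d}$) gives $$\min_x\max_{p,x^*,y^*,\pi}\ c^Tx+(d-Bx)^T\pi-c^Tx^*-p^TAy^*$$ subject to $C^T\pi\le A^Tp$, $Bx^*+Cy^*\ge d$, $Ep\ge f$, $Gx\ge h$, $x,p,\pi,x^*,y^*\ge0$. **Subproblem.** Let $$S=\{(p,x^*,y^*,\pi)\in\mathbb R_{\ge0}^{n_p+n_x+n_y+n_d}\mid C^T\pi\le A^Tp,\ Bx^*+Cy^*\ge d,\ Ep\ge f\}.$$ For given $x$, $$SP(x):\quad sp(x)=\max_{(p,x^*,y^*,\pi)\in S}\ (d-Bx)^T\pi-c^Tx^*-p^TAy^*.$$ A solution of $SP(x)$ is always assumed to be chosen in a vertex of the polyhedron $S$ defining the feasible region. **Main problems.** For tuples $(p_l,x_l^*,y_l^*,\pi_l)\in S$, $$MP^{CG}(k):\quad\min_{x,\eta}\ c^Tx+\eta\quad\text{s.t. }\eta\ge(d-Bx)^T\pi_l-c^Tx_l^*-p_l^TAy_l^*\ \ \forall\,1\le l\le k,\quad Gx\ge h,\ x\ge0,\ \eta\in\mathbb R,$$ $$MP^{C\&CG}(k):\quad\min_{x,\eta,y_1,\dots,y_k}\ c^Tx+\eta\quad\text{s.t. }\eta\ge p_l^TAy_l-c^Tx_l^*-p_l^TAy_l^*,\ \ Bx+Cy_l\ge d,\ \ y_l\ge0\ \ \forall\,1\le l\le k,\quad Gx\ge h,\ x\ge0,\ \eta\in\mathbb R.$$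 For $k=0$ there is no constraint bounding $\eta$. Solutions of the main problems are assumed to be obtained at vertices of the polyhedron defining the feasible region. **Algorithms.** The following procedure is called the C\&CG algorithm if $MP=MP^{C\&CG}$, and the CG (dual) algorithm if $MP=MP^{CG}$. Input $\varepsilon\ge0$ (the predefined solution quality); start with $lb=-\infty$, $ub=+\infty$, $k=0$. Let $x_0,\eta_0$ be obtained from a solution of $MP(0)$ and let $(p_1,x_1^*,y_1^*,\pi_1)$ be a solution of $SP(x_0)$; set $lb\gets\max\{lb,c^Tx_0+\eta_0\}$, $ub\gets\min\{ub,c^Tx_0+sp(x_0)\}$, $k\gets1$. While $ub-lb>\varepsilon$: let $x_k,\eta_k$ be obtained from a solution of $MP(k)$ and let $(p_{k+1},x_{k+1}^*,y_{k+1}^*,\pi_{k+1})$ be a solution of $SP(x_k)$; set $lb\gets\max\{lb,c^Tx_k+\eta_k\}$, $ub\gets\min\{ub,c^Tx_k+sp(x_k)\}$, $k\gets k+1$. When the loop ends, return $x_{k-1}$, the last computed iterate.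
   Formalization: "Maximum possible number of steps" is read as the bound given by the convergence proof (number of p-values of vertices of S plus 1, versus number of vertices of S plus 1); comparing the longest actual runs on one instance is false, since C&CG can take 5 steps where CG never exceeds 4. *)

theory Defs
  imports "HOL-Analysis.Analysis"
begin

text \<open>Inequalities between vectors in \<open>real ^ 'n\<close> are componentwise.\<close>

record ('nx::finite, 'np::finite, 'ny::finite, 'nd::finite, 'nf::finite, 'nh::finite) problem =
  cvec :: "real ^ 'nx"
  dvec :: "real ^ 'nd"
  fvec :: "real ^ 'nf"
  hvec :: "real ^ 'nh"
  Amat :: "real ^ 'ny ^ 'np"
  Bmat :: "real ^ 'nx ^ 'nd"
  Cmat :: "real ^ 'ny ^ 'nd"
  Emat :: "real ^ 'np ^ 'nf"
  Gmat :: "real ^ 'nx ^ 'nh"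

type_synonym ('nx, 'np, 'ny, 'nd) tuple =
  "(real ^ 'np) \<times> (real ^ 'nx) \<times> (real ^ 'ny) \<times> (real ^ 'nd)"


section \<open>The minimax regret problem\<close>

definition first_stage ::
  "('nx::finite, 'np::finite, 'ny::finite, 'nd::finite, 'nf::finite, 'nh::finite) problem
    \<Rightarrow> (real ^ 'nx) set" where
  "first_stage D = {x. hvec D \<le> Gmat D *v x \<and> 0 \<le> x}"

definition middle_stage ::
  "('nx::finite, 'np::finite, 'ny::finite, 'nd::finite, 'nf::finite, 'nh::finite) problem
    \<Rightarrow> ((real ^ 'np) \<times> (real ^ 'nx) \<times> (real ^ 'ny)) set" where
  "middle_stage D = {(p, xs, ys). fvec D \<le> Emat D *v p \<and> dvec D \<le> Bmat D *v xs + Cmat D *v ys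
      \<and> 0 \<le> p \<and> 0 \<le> xs \<and> 0 \<le> ys}"

definition second_stage ::
  "('nx::finite, 'np::finite, 'ny::finite, 'nd::finite, 'nf::finite, 'nh::finite) problem
    \<Rightarrow> real ^ 'nx \<Rightarrow> (real ^ 'ny) set" where
  "second_stage D x = {y. dvec D \<le> Bmat D *v x + Cmat D *v y \<and> 0 \<le> y}"

text \<open>The optimal value, as an extended real number, of the reformulation in which the inner
  minimum over \<open>(xs, ys)\<close> has been merged into the middle stage.\<close>

definition minimax_regret ::
  "('nx::finite, 'np::finite, 'ny::finite, 'nd::finite, 'nf::finite, 'nh::finite) problem
    \<Rightarrow> ereal" where
  "minimax_regret D =
    (INF x\<in>first_stage D. SUP (p, xs, ys)\<in>middle_stage D. INF y\<in>second_stage D x.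
      ereal (cvec D \<bullet> x + p \<bullet> (Amat D *v y) - cvec D \<bullet> xs - p \<bullet> (Amat D *v ys)))"

definition relatively_complete_recourse ::
  "('nx::finite, 'np::finite, 'ny::finite, 'nd::finite, 'nf::finite, 'nh::finite) problem
    \<Rightarrow> bool" where
  "relatively_complete_recourse D \<longleftrightarrow>
    (\<forall>x\<in>first_stage D. \<forall>(p, xs, ys)\<in>middle_stage D. \<exists>y. y \<in> second_stage D x)"


section \<open>The subproblem\<close>

definition subproblem_polyhedron ::
  "('nx::finite, 'np::finite, 'ny::finite, 'nd::finite, 'nf::finite, 'nh::finite) problem
    \<Rightarrow> ('nx, 'np, 'ny, 'nd) tuple set" where
  "subproblem_polyhedron D = {(p, xs, ys, \<pi>).
      0 \<le> p \<and> 0 \<le> xs \<and> 0 \<le> ys \<and> 0 \<le> \<pi>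
      \<and> transpose (Cmat D) *v \<pi> \<le> transpose (Amat D) *v p
      \<and> dvec D \<le> Bmat D *v xs + Cmat D *v ys \<and> fvec D \<le> Emat D *v p}"

definition subproblem_vertices ::
  "('nx::finite, 'np::finite, 'ny::finite, 'nd::finite, 'nf::finite, 'nh::finite) problem
    \<Rightarrow> ('nx, 'np, 'ny, 'nd) tuple set" where
  "subproblem_vertices D = {v. v extreme_point_of subproblem_polyhedron D}"

definition vertex_p_values ::
  "('nx::finite, 'np::finite, 'ny::finite, 'nd::finite, 'nf::finite, 'nh::finite) problem
    \<Rightarrow> (real ^ 'np) set" where
  "vertex_p_values D = (\<lambda>(p, xs, ys, \<pi>). p) ` subproblem_vertices D"

fun sp_objective ::
  "('nx::finite, 'np::finite, 'ny::finite, 'nd::finite, 'nf::finite, 'nh::finite) problem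
    \<Rightarrow> real ^ 'nx \<Rightarrow> ('nx, 'np, 'ny, 'nd) tuple \<Rightarrow> real" where
  "sp_objective D x (p, xs, ys, \<pi>) =
    (dvec D - Bmat D *v x) \<bullet> \<pi> - cvec D \<bullet> xs - p \<bullet> (Amat D *v ys)"

definition sp ::
  "('nx::finite, 'np::finite, 'ny::finite, 'nd::finite, 'nf::finite, 'nh::finite) problem
    \<Rightarrow> real ^ 'nx \<Rightarrow> ereal" where
  "sp D x = (SUP v\<in>subproblem_polyhedron D. ereal (sp_objective D x v))"

definition sp_solution ::
  "('nx::finite, 'np::finite, 'ny::finite, 'nd::finite, 'nf::finite, 'nh::finite) problem
    \<Rightarrow> real ^ 'nx \<Rightarrow> ('nx, 'np, 'ny, 'nd) tuple \<Rightarrow> bool" where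
  "sp_solution D x v \<longleftrightarrow> v \<in> subproblem_vertices D
    \<and> (\<forall>w\<in>subproblem_polyhedron D. sp_objective D x w \<le> sp_objective D x v)"


section \<open>The main problems\<close>

text \<open>The tuples are numbered from 1, so \<open>v l\<close> for \<open>1 \<le> l \<le> k\<close> are those entering the
  \<open>k\<close>-th main problem. For \<open>k = 0\<close> the variable \<open>\<eta>\<close> is unbounded below: the optimal value is
  \<open>-\<infinity>\<close>, so that \<open>\<eta>\<^sub>0 = -\<infinity>\<close>, and any feasible \<open>x\<close> may serve as \<open>x\<^sub>0\<close> (the feasible region
  contains a line, hence has no vertices).\<close>

definition cg_feasible ::
  "('nx::finite, 'np::finite, 'ny::finite, 'nd::finite, 'nf::finite, 'nh::finite) problem
    \<Rightarrow> (nat \<Rightarrow> ('nx, 'np, 'ny, 'nd) tuple) \<Rightarrow> nat \<Rightarrow> ((real ^ 'nx) \<times> real) set" where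
  "cg_feasible D v k = {(x, \<eta>). x \<in> first_stage D \<and> (\<forall>l\<in>{1..k}. sp_objective D x (v l) \<le> \<eta>)}"

definition cg_main_solution ::
  "('nx::finite, 'np::finite, 'ny::finite, 'nd::finite, 'nf::finite, 'nh::finite) problem
    \<Rightarrow> (nat \<Rightarrow> ('nx, 'np, 'ny, 'nd) tuple) \<Rightarrow> nat \<Rightarrow> real ^ 'nx \<Rightarrow> ereal \<Rightarrow> bool" where
  "cg_main_solution D v k x \<eta> \<longleftrightarrow>
    (if k = 0 then x \<in> first_stage D \<and> \<eta> = -\<infinity>
     else \<exists>r. \<eta> = ereal r \<and> (x, r) extreme_point_of cg_feasible D v k
       \<and> (\<forall>(x', r')\<in>cg_feasible D v k. cvec D \<bullet> x + r \<le> cvec D \<bullet> x' + r'))"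

text \<open>The constraints on \<open>(x, \<eta>, y)\<close> that one tuple contributes to a C\&CG main problem.\<close>

fun ccg_constraint ::
  "('nx::finite, 'np::finite, 'ny::finite, 'nd::finite, 'nf::finite, 'nh::finite) problem
    \<Rightarrow> ('nx, 'np, 'ny, 'nd) tuple \<Rightarrow> ((real ^ 'nx) \<times> real \<times> (real ^ 'ny)) set" where
  "ccg_constraint D (p, xs, ys, \<pi>) =
    {(x, \<eta>, y). p \<bullet> (Amat D *v y) - cvec D \<bullet> xs - p \<bullet> (Amat D *v ys) \<le> \<eta>
      \<and> dvec D \<le> Bmat D *v x + Cmat D *v y \<and> 0 \<le> y}"

text \<open>The second stage variables \<open>y\<^sub>1, \<dots>, y\<^sub>k\<close> are the values \<open>y 1, \<dots>, y k\<close> of a function on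
  the natural numbers; its other values play no role. As the number of variables depends on
  \<open>k\<close>, the definition of an extreme point is written out on the coordinates that matter.\<close>

definition ccg_feasible ::
  "('nx::finite, 'np::finite, 'ny::finite, 'nd::finite, 'nf::finite, 'nh::finite) problem
    \<Rightarrow> (nat \<Rightarrow> ('nx, 'np, 'ny, 'nd) tuple) \<Rightarrow> nat
    \<Rightarrow> ((real ^ 'nx) \<times> real \<times> (nat \<Rightarrow> real ^ 'ny)) set" where
  "ccg_feasible D v k =
    {(x, \<eta>, y). x \<in> first_stage D \<and> (\<forall>l\<in>{1..k}. (x, \<eta>, y l) \<in> ccg_constraint D (v l))}"

definition ccg_vertex ::
  "('nx::finite, 'np::finite, 'ny::finite, 'nd::finite, 'nf::finite, 'nh::finite) problem
    \<Rightarrow> (nat \<Rightarrow> ('nx, 'np, 'ny, 'nd) tuple) \<Rightarrow> nat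
    \<Rightarrow> real ^ 'nx \<Rightarrow> real \<Rightarrow> (nat \<Rightarrow> real ^ 'ny) \<Rightarrow> bool" where
  "ccg_vertex D v k x r y \<longleftrightarrow> (x, r, y) \<in> ccg_feasible D v k
    \<and> (\<forall>(x1, r1, y1)\<in>ccg_feasible D v k. \<forall>(x2, r2, y2)\<in>ccg_feasible D v k. \<forall>u.
        0 < u \<and> u < 1
        \<and> x = (1 - u) *\<^sub>R x1 + u *\<^sub>R x2 \<and> r = (1 - u) * r1 + u * r2
        \<and> (\<forall>l\<in>{1..k}. y l = (1 - u) *\<^sub>R y1 l + u *\<^sub>R y2 l)
        \<longrightarrow> x1 = x2 \<and> r1 = r2 \<and> (\<forall>l\<in>{1..k}. y1 l = y2 l))"

definition ccg_main_solution ::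
  "('nx::finite, 'np::finite, 'ny::finite, 'nd::finite, 'nf::finite, 'nh::finite) problem
    \<Rightarrow> (nat \<Rightarrow> ('nx, 'np, 'ny, 'nd) tuple) \<Rightarrow> nat \<Rightarrow> real ^ 'nx \<Rightarrow> ereal \<Rightarrow> bool" where
  "ccg_main_solution D v k x \<eta> \<longleftrightarrow>
    (if k = 0 then x \<in> first_stage D \<and> \<eta> = -\<infinity>
     else \<exists>r y. \<eta> = ereal r \<and> ccg_vertex D v k x r y
       \<and> (\<forall>(x', r', y')\<in>ccg_feasible D v k. cvec D \<bullet> x + r \<le> cvec D \<bullet> x' + r'))"


section \<open>The algorithms\<close>

text \<open>\<open>lower_bound D x \<eta> k\<close> and \<open>upper_bound D x k\<close> are the values of \<open>lb\<close> and \<open>ub\<close> after \<open>k\<close>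
  iterations, that is, after \<open>k\<close> main problems and \<open>k\<close> subproblems have been solved.\<close>

primrec lower_bound ::
  "('nx::finite, 'np::finite, 'ny::finite, 'nd::finite, 'nf::finite, 'nh::finite) problem
    \<Rightarrow> (nat \<Rightarrow> real ^ 'nx) \<Rightarrow> (nat \<Rightarrow> ereal) \<Rightarrow> nat \<Rightarrow> ereal" where
  "lower_bound D x \<eta> 0 = -\<infinity>"
| "lower_bound D x \<eta> (Suc k) = max (lower_bound D x \<eta> k) (ereal (cvec D \<bullet> x k) + \<eta> k)"

primrec upper_bound ::
  "('nx::finite, 'np::finite, 'ny::finite, 'nd::finite, 'nf::finite, 'nh::finite) problem
    \<Rightarrow> (nat \<Rightarrow> real ^ 'nx) \<Rightarrow> nat \<Rightarrow> ereal" where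
  "upper_bound D x 0 = \<infinity>"
| "upper_bound D x (Suc k) = min (upper_bound D x k) (ereal (cvec D \<bullet> x k) + sp D (x k))"

definition gap ::
  "('nx::finite, 'np::finite, 'ny::finite, 'nd::finite, 'nf::finite, 'nh::finite) problem
    \<Rightarrow> (nat \<Rightarrow> real ^ 'nx) \<Rightarrow> (nat \<Rightarrow> ereal) \<Rightarrow> nat \<Rightarrow> ereal" where
  "gap D x \<eta> k = upper_bound D x k - lower_bound D x \<eta> k"

text \<open>\<open>execution D \<epsilon> mp x \<eta> v K\<close>: the algorithm whose main problem has the solutions given by
  \<open>mp\<close> performs (at least) \<open>K\<close> iterations, with iterates \<open>x k\<close>, \<open>\<eta> k\<close> and tuples \<open>v (k + 1)\<close> for
  \<open>k < K\<close>. The first iteration, which precedes the loop, needs no special treatment: the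
  initial gap is \<open>\<infinity>\<close>, so the loop condition holds trivially for \<open>k = 0\<close>.\<close>

definition execution ::
  "('nx::finite, 'np::finite, 'ny::finite, 'nd::finite, 'nf::finite, 'nh::finite) problem
    \<Rightarrow> real \<Rightarrow> ((nat \<Rightarrow> ('nx, 'np, 'ny, 'nd) tuple) \<Rightarrow> nat \<Rightarrow> real ^ 'nx \<Rightarrow> ereal \<Rightarrow> bool)
    \<Rightarrow> (nat \<Rightarrow> real ^ 'nx) \<Rightarrow> (nat \<Rightarrow> ereal) \<Rightarrow> (nat \<Rightarrow> ('nx, 'np, 'ny, 'nd) tuple)
    \<Rightarrow> nat \<Rightarrow> bool" where
  "execution D \<epsilon> mp x \<eta> v K \<longleftrightarrow>
    (\<forall>k<K. gap D x \<eta> k > ereal \<epsilon> \<and> mp v k (x k) (\<eta> k) \<and> sp_solution D (x k) (v (Suc k)))"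

text \<open>A complete run: as long as the loop condition holds, solutions of the main problem and of
  the subproblem are obtained and the algorithm goes on.\<close>

definition algorithm_run ::
  "('nx::finite, 'np::finite, 'ny::finite, 'nd::finite, 'nf::finite, 'nh::finite) problem
    \<Rightarrow> real \<Rightarrow> ((nat \<Rightarrow> ('nx, 'np, 'ny, 'nd) tuple) \<Rightarrow> nat \<Rightarrow> real ^ 'nx \<Rightarrow> ereal \<Rightarrow> bool)
    \<Rightarrow> (nat \<Rightarrow> real ^ 'nx) \<Rightarrow> (nat \<Rightarrow> ereal) \<Rightarrow> (nat \<Rightarrow> ('nx, 'np, 'ny, 'nd) tuple)
    \<Rightarrow> bool" where
  "algorithm_run D \<epsilon> mp x \<eta> v \<longleftrightarrow>
    (\<forall>K. execution D \<epsilon> mp x \<eta> v K \<and> gap D x \<eta> K > ereal \<epsilon> \<longrightarrow> execution D \<epsilon> mp x \<eta> v (Suc K))"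

text \<open>The algorithm finishes after finitely many iterations, and at most \<open>N\<close> iterations are
  possible. At every moment the two bounds enclose the optimal value, so at the end they
  determine it up to \<open>\<epsilon>\<close>.\<close>

definition converges_within ::
  "('nx::finite, 'np::finite, 'ny::finite, 'nd::finite, 'nf::finite, 'nh::finite) problem
    \<Rightarrow> real \<Rightarrow> ((nat \<Rightarrow> ('nx, 'np, 'ny, 'nd) tuple) \<Rightarrow> nat \<Rightarrow> real ^ 'nx \<Rightarrow> ereal \<Rightarrow> bool)
    \<Rightarrow> nat \<Rightarrow> bool" where
  "converges_within D \<epsilon> mp N \<longleftrightarrow>
    (\<forall>x \<eta> v.
      (\<forall>K. execution D \<epsilon> mp x \<eta> v K \<longrightarrow>
        K \<le> N \<and> lower_bound D x \<eta> K \<le> minimax_regret D \<and> minimax_regret D \<le> upper_bound D x K)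
      \<and> (algorithm_run D \<epsilon> mp x \<eta> v \<longrightarrow>
        (\<exists>K. execution D \<epsilon> mp x \<eta> v K \<and> gap D x \<eta> K \<le> ereal \<epsilon>)))"

end

theory Submission
  imports Defs
begin

text \<open>In the C\&CG algorithm a value of \<open>p\<close> repeats only when the gap closes. Suppose that
  the tuple found in iteration \<open>k\<close>, a solution of the subproblem at \<open>x k\<close>, has the same \<open>p\<close> as an
  earlier tuple. For fixed \<open>p\<close> the subproblem separates into a problem in \<open>(xs, ys)\<close>, which does not
  involve \<open>x\<close>, and one in \<open>\<pi>\<close>; so both tuples have the same value of \<open>cvec D \<bullet> xs + p \<bullet> (Amat D *v ys)\<close>
  and contribute the same C\&CG constraint (\<open>ccg_constraint_eq\<close>). By weak duality this constraint
  forces \<open>\<eta> k \<ge> sp D (x k)\<close> (\<open>ccg_constraint_imp_cut\<close>), which makes the lower bound at least as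
  large as the upper one. For the dual algorithm the same happens when the whole tuple repeats.
  Hence, apart from the last tuple, the \<open>p\<close>-values (respectively the tuples) are distinct, and they
  come from the finitely many vertices of a polyhedron. The locale \<open>cut_scheme\<close> carries out this
  argument for both algorithms.

  The lower bound is valid because the main problems are relaxations, which needs weak duality only;
  the upper bound is valid by strong duality for the second stage
  (\<open>minimax_regret_le_subproblem\<close>), where relatively complete recourse gives feasibility. Strong
  duality rests on Farkas' lemma, proved by induction on the number of inequalities.

  That vertices can outnumber their \<open>p\<close>-values exponentially is seen as follows: the subproblem of \<open>cube_problem\<close> has a single
  feasible \<open>p\<close>, while \<open>\<pi>\<close> ranges over a unit cube, every vertex of which is optimal for some first
  stage decision.\<close>


section \<open>Linear programming duality\<close>

lemma inner_mono_vec: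
  fixes u v w :: "real ^ 'n"
  assumes "u \<le> v" and "0 \<le> w"
  shows "u \<bullet> w \<le> v \<bullet> w"
  using assms unfolding inner_vec_def less_eq_vec_def
  by (auto intro!: sum_mono mult_right_mono)

lemma inner_matrix_vector_transpose:
  fixes M :: "real ^ 'n ^ 'm"
  shows "p \<bullet> (M *v y) = (transpose M *v p) \<bullet> y"
  by (simp add: dot_lmul_matrix transpose_matrix_vector)

text \<open>Farkas' lemma for finitely many functionals. The induction removes one functional at a time, so
  that no closedness of finitely generated cones is needed.\<close>

lemma farkas:
  fixes a :: "'i \<Rightarrow> 'a::real_inner"
  assumes "finite I"
    and "\<And>x. (\<forall>i\<in>I. 0 \<le> a i \<bullet> x) \<Longrightarrow> 0 \<le> g \<bullet> x"
  shows "\<exists>l. (\<forall>i\<in>I. 0 \<le> l i) \<and> g = (\<Sum>i\<in>I. l i *\<^sub>R a i)"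
  using assms
proof (induction I arbitrary: a g rule: finite_induct)
  case empty
  have "0 \<le> g \<bullet> (- g)" using empty by blast
  then have "g = 0"
    by (metis inner_eq_zero_iff inner_ge_zero inner_minus_right neg_0_le_iff_le order_antisym)
  then show ?case by simp
next
  case (insert m F)
  show ?case
  proof (cases "\<forall>x. (\<forall>i\<in>F. 0 \<le> a i \<bullet> x) \<longrightarrow> 0 \<le> g \<bullet> x")
    case True
    then obtain l where l: "\<forall>i\<in>F. 0 \<le> l i" "g = (\<Sum>i\<in>F. l i *\<^sub>R a i)"
      using insert.IH[of a g] by blast
    have "(\<Sum>i\<in>F. (l(m := 0)) i *\<^sub>R a i) = (\<Sum>i\<in>F. l i *\<^sub>R a i)"
      using insert.hyps by (intro sum.cong) auto
    then have "(\<forall>i\<in>insert m F. 0 \<le> (l(m := 0)) i)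
        \<and> g = (\<Sum>i\<in>insert m F. (l(m := 0)) i *\<^sub>R a i)"
      using l insert.hyps by simp
    then show ?thesis by blast
  next
    case False
    then obtain z0 where z0: "\<forall>i\<in>F. 0 \<le> a i \<bullet> z0" "g \<bullet> z0 < 0" by (auto simp: not_le)
    have neg: "a m \<bullet> z0 < 0"
      using insert.prems[of z0] z0 by fastforce
    define z where "z = (1 / - (a m \<bullet> z0)) *\<^sub>R z0"
    have z: "\<forall>i\<in>F. 0 \<le> a i \<bullet> z" "g \<bullet> z < 0" "a m \<bullet> z = -1"
      using z0 neg unfolding z_def
      by (auto simp: divide_simps mult_less_0_iff)
    \<comment> \<open>Precompose all functionals with the projection along \<open>z\<close> onto the hyperplane on which \<open>a m\<close>
      vanishes: there the inequality of \<open>a m\<close> holds automatically, and the induction hypothesis applies.\<close>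
    define a' where "a' i = a i + (a i \<bullet> z) *\<^sub>R a m" for i
    define g' where "g' = g + (g \<bullet> z) *\<^sub>R a m"
    have proj: "(w + (w \<bullet> z) *\<^sub>R a m) \<bullet> x = w \<bullet> (x + (a m \<bullet> x) *\<^sub>R z)" for w x
      by (simp add: inner_add_left inner_add_right)
    have "0 \<le> g' \<bullet> x" if "\<forall>i\<in>F. 0 \<le> a' i \<bullet> x" for x
    proof -
      have "a m \<bullet> (x + (a m \<bullet> x) *\<^sub>R z) = 0" by (simp add: inner_add_right z)
      then show ?thesis
        using that insert.prems[of "x + (a m \<bullet> x) *\<^sub>R z"] unfolding a'_def g'_def proj by simp
    qed
    then obtain l where l: "\<forall>i\<in>F. 0 \<le> l i" "g' = (\<Sum>i\<in>F. l i *\<^sub>R a' i)"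
      using insert.IH[of a' g'] by blast
    define c where "c = (\<Sum>i\<in>F. l i * (a i \<bullet> z)) - g \<bullet> z"
    have "0 \<le> (\<Sum>i\<in>F. l i * (a i \<bullet> z))" using l z by (intro sum_nonneg) auto
    then have c: "0 \<le> c" using z unfolding c_def by simp
    have "(\<Sum>i\<in>F. l i *\<^sub>R a' i) = (\<Sum>i\<in>F. l i *\<^sub>R a i) + (\<Sum>i\<in>F. l i * (a i \<bullet> z)) *\<^sub>R a m"
      unfolding a'_def by (simp add: scaleR_add_right sum.distrib scaleR_left.sum)
    then have g: "g = c *\<^sub>R a m + (\<Sum>i\<in>F. l i *\<^sub>R a i)"
      using l(2) unfolding g'_def c_def by (simp add: algebra_simps)
    have "(\<Sum>i\<in>F. (l(m := c)) i *\<^sub>R a i) = (\<Sum>i\<in>F. l i *\<^sub>R a i)"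
      using insert.hyps by (intro sum.cong) auto
    then have "(\<forall>i\<in>insert m F. 0 \<le> (l(m := c)) i)
        \<and> g = (\<Sum>i\<in>insert m F. (l(m := c)) i *\<^sub>R a i)"
      using l c g insert.hyps by simp
    then show ?thesis by blast
  qed
qed

text \<open>Strong duality in the form of a certificate: a lower bound of a feasible minimisation problem
  is witnessed by a dual feasible point. It is Farkas' lemma for the homogenised problem in the
  variables \<open>(y, t)\<close> with \<open>t \<ge> 0\<close>; the case \<open>t = 0\<close> is where feasibility is needed.\<close>

lemma lp_dual_certificate:
  fixes C :: "real ^ 'n ^ 'm"
  assumes feas: "b \<le> C *v y0" "0 \<le> y0"
    and bnd: "\<And>y. b \<le> C *v y \<Longrightarrow> 0 \<le> y \<Longrightarrow> \<alpha> \<le> q \<bullet> y"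
  shows "\<exists>\<pi>. 0 \<le> \<pi> \<and> transpose C *v \<pi> \<le> q \<and> \<alpha> \<le> b \<bullet> \<pi>"
proof -
  \<comment> \<open>The inequalities \<open>y \<ge> 0\<close>, \<open>C *v y \<ge> t *\<^sub>R b\<close> and \<open>t \<ge> 0\<close>.\<close>
  define a :: "('n + 'm) + unit \<Rightarrow> (real ^ 'n) \<times> real" where
    "a = case_sum (case_sum (\<lambda>j. (axis j 1, 0)) (\<lambda>i. (row i C, - b $ i))) (\<lambda>_. (0, 1))"
  have hom: "0 \<le> (q, - \<alpha>) \<bullet> yt" if "\<forall>i\<in>UNIV. 0 \<le> a i \<bullet> yt" for yt
  proof -
    obtain y t where yt: "yt = (y, t)" by (cases yt)
    have a1: "0 \<le> a (Inl (Inl j)) \<bullet> yt" and a2: "0 \<le> a (Inl (Inr i)) \<bullet> yt"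
      and a3: "0 \<le> a (Inr ()) \<bullet> yt" for i j
      using that by blast+
    have y: "0 \<le> y" using a1 by (simp add: a_def yt less_eq_vec_def inner_axis')
    have t: "0 \<le> t" using a3 by (simp add: a_def yt)
    have Cy: "t *\<^sub>R b \<le> C *v y"
      using a2 by (simp add: a_def yt less_eq_vec_def matrix_vector_mul_component row_def mult.commute
        vec_lambda_eta)
    show ?thesis
    proof (cases "t = 0")
      case False
      then have tp: "0 < t" using t by simp
      have "\<alpha> \<le> q \<bullet> ((1 / t) *\<^sub>R y)"
      proof (rule bnd)
        show "b \<le> C *v ((1 / t) *\<^sub>R y)"
          using Cy tp by (simp add: less_eq_vec_def matrix_vector_mult_scaleR field_simps)
        show "0 \<le> (1 / t) *\<^sub>R y" using y tp by (simp add: less_eq_vec_def)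
      qed
      then show ?thesis using tp by (simp add: yt field_simps)
    next
      case True
      show ?thesis
      proof (rule ccontr)
        assume "\<not> ?thesis"
        then have neg: "q \<bullet> y < 0" by (simp add: yt True)
        have "\<alpha> \<le> q \<bullet> y0" using feas bnd by blast
        \<comment> \<open>A step along the ray \<open>y\<close> long enough for the objective to drop to \<open>\<alpha> - 1\<close>.\<close>
        define s where "s = (q \<bullet> y0 - \<alpha> + 1) / - (q \<bullet> y)"
        have s: "0 \<le> s" using neg \<open>\<alpha> \<le> q \<bullet> y0\<close> by (simp add: s_def divide_nonneg_neg)
        have "\<alpha> \<le> q \<bullet> (y0 + s *\<^sub>R y)"
        proof (rule bnd)
          have "0 \<le> s * (C *v y) $ i" for i
            using Cy s by (simp add: True less_eq_vec_def)
          then show "b \<le> C *v (y0 + s *\<^sub>R y)"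
            using feas(1)
            by (simp add: less_eq_vec_def matrix_vector_right_distrib matrix_vector_mult_scaleR
              add_increasing2)
          show "0 \<le> y0 + s *\<^sub>R y" using feas(2) y s by (simp add: less_eq_vec_def)
        qed
        moreover have "s * (q \<bullet> y) = - (q \<bullet> y0 - \<alpha> + 1)" using neg by (simp add: s_def)
        ultimately show False by (simp add: inner_add_right)
      qed
    qed
  qed
  have "\<exists>l. (\<forall>i\<in>UNIV. 0 \<le> l i) \<and> (q, - \<alpha>) = (\<Sum>i\<in>UNIV. l i *\<^sub>R a i)"
    by (rule farkas) (simp_all only: finite hom)
  then obtain l where l: "\<forall>i\<in>UNIV. 0 \<le> l i" "(q, - \<alpha>) = (\<Sum>i\<in>UNIV. l i *\<^sub>R a i)"
    by blast
  define \<pi> where "\<pi> = (\<chi> i. l (Inl (Inr i)))"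
  have split: "(\<Sum>i\<in>UNIV. l i *\<^sub>R a i) = (\<Sum>j\<in>UNIV. l (Inl (Inl j)) *\<^sub>R a (Inl (Inl j)))
      + (\<Sum>i\<in>UNIV. l (Inl (Inr i)) *\<^sub>R a (Inl (Inr i))) + l (Inr ()) *\<^sub>R a (Inr ())"
    by (simp add: UNIV_Plus_UNIV[symmetric] sum.Plus UNIV_unit del: UNIV_Plus_UNIV)
  have q: "q = (\<Sum>j\<in>UNIV. l (Inl (Inl j)) *\<^sub>R axis j 1) + (\<Sum>i\<in>UNIV. \<pi> $ i *\<^sub>R row i C)"
    using arg_cong[OF l(2)[unfolded split], of fst]
    by (simp add: a_def fst_sum \<pi>_def)
  have \<alpha>: "- \<alpha> = (\<Sum>i\<in>UNIV. \<pi> $ i * (- b $ i)) + l (Inr ())"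
    using arg_cong[OF l(2)[unfolded split], of snd]
    by (simp add: a_def snd_sum \<pi>_def)
  have "(transpose C *v \<pi>) $ j = q $ j - l (Inl (Inl j))" for j
  proof -
    have "(\<Sum>x\<in>UNIV. l (Inl (Inl x)) * axis x 1 $ j) = l (Inl (Inl j))"
      by (simp add: axis_def if_distrib cong: if_cong)
    then show ?thesis
      by (subst q) (simp add: matrix_vector_mult_def transpose_def row_def mult.commute)
  qed
  then have "transpose C *v \<pi> \<le> q" using l(1) by (simp add: less_eq_vec_def)
  moreover have "0 \<le> \<pi>" using l(1) by (simp add: \<pi>_def less_eq_vec_def)
  moreover have "\<alpha> \<le> b \<bullet> \<pi>"
    using \<alpha> l(1)[rule_format, of "Inr ()"]
    by (simp add: inner_vec_def sum_negf mult.commute)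
  ultimately show ?thesis by blast
qed


section \<open>Vertices of the subproblem polyhedron\<close>

lemma polyhedron_linear_ge:
  fixes L :: "'a::euclidean_space \<Rightarrow> real ^ 'm"
  assumes "linear L"
  shows "polyhedron {v. b \<le> L v}"
proof -
  have "adjoint L (axis i 1) \<bullet> v = L v $ i" for i v
    by (simp add: adjoint_clauses(2)[OF assms] inner_axis')
  then have "{v. b \<le> L v} = (\<Inter>i\<in>UNIV. {v. adjoint L (axis i 1) \<bullet> v \<ge> b $ i})"
    by (auto simp: less_eq_vec_def)
  also have "polyhedron \<dots>" by (intro polyhedron_Inter) (auto intro: polyhedron_halfspace_ge)
  finally show ?thesis .
qed

lemma polyhedron_subproblem:
  fixes D :: "('nx::finite, 'np::finite, 'ny::finite, 'nd::finite, 'nf::finite, 'nh::finite) problem"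
  shows "polyhedron (subproblem_polyhedron D)"
proof -
  have mv: "linear (\<lambda>v. M *v f v)" if "linear f" for M :: "real ^ 'n ^ 'm"
    and f :: "'e::euclidean_space \<Rightarrow> real ^ 'n"
    using linear_compose[OF that matrix_vector_mul_linear, of M] by (simp add: o_def)
  let ?p = "\<lambda>v::('nx, 'np, 'ny, 'nd) tuple. fst v"
  let ?xs = "\<lambda>v::('nx, 'np, 'ny, 'nd) tuple. fst (snd v)"
  let ?ys = "\<lambda>v::('nx, 'np, 'ny, 'nd) tuple. fst (snd (snd v))"
  let ?\<pi> = "\<lambda>v::('nx, 'np, 'ny, 'nd) tuple. snd (snd (snd v))"
  have lin: "linear ?p" "linear ?xs" "linear ?ys" "linear ?\<pi>"
    by (auto intro!: linearI)
  have "subproblem_polyhedron D =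
      {v. 0 \<le> ?p v} \<inter> {v. 0 \<le> ?xs v} \<inter> {v. 0 \<le> ?ys v} \<inter> {v. 0 \<le> ?\<pi> v}
      \<inter> {v. 0 \<le> transpose (Amat D) *v ?p v - transpose (Cmat D) *v ?\<pi> v}
      \<inter> {v. dvec D \<le> Bmat D *v ?xs v + Cmat D *v ?ys v} \<inter> {v. fvec D \<le> Emat D *v ?p v}"
    unfolding subproblem_polyhedron_def by (auto simp: less_eq_vec_def)
  also have "polyhedron \<dots>"
    by (intro polyhedron_Int polyhedron_linear_ge linear_compose_sub linear_compose_add mv lin)
  finally show ?thesis .
qed

lemma finite_subproblem_vertices: "finite (subproblem_vertices D)"
  unfolding subproblem_vertices_def
  by (rule finite_polyhedron_extreme_points[OF polyhedron_subproblem])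

lemma vertex_p_values_eq: "vertex_p_values D = fst ` subproblem_vertices D"
  unfolding vertex_p_values_def by (rule image_cong) auto

lemma subproblem_vertices_subset: "subproblem_vertices D \<subseteq> subproblem_polyhedron D"
  unfolding subproblem_vertices_def extreme_point_of_def by blast

lemma subproblem_polyhedron_iff:
  "(p, xs, ys, \<pi>) \<in> subproblem_polyhedron D \<longleftrightarrow>
    (p, xs, ys) \<in> middle_stage D \<and> 0 \<le> \<pi> \<and> transpose (Cmat D) *v \<pi> \<le> transpose (Amat D) *v p"
  unfolding subproblem_polyhedron_def middle_stage_def by auto


section \<open>Bounds on the regret\<close>

lemma weak_duality:
  assumes "(p, xs, ys, \<pi>) \<in> subproblem_polyhedron D" and "y \<in> second_stage D x"
  shows "(dvec D - Bmat D *v x) \<bullet> \<pi> \<le> p \<bullet> (Amat D *v y)"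
proof -
  have y: "dvec D - Bmat D *v x \<le> Cmat D *v y" "0 \<le> y"
    using assms(2) by (auto simp: second_stage_def less_eq_vec_def algebra_simps)
  have \<pi>: "0 \<le> \<pi>" "transpose (Cmat D) *v \<pi> \<le> transpose (Amat D) *v p"
    using assms(1) by (auto simp: subproblem_polyhedron_def)
  have "(dvec D - Bmat D *v x) \<bullet> \<pi> \<le> \<pi> \<bullet> (Cmat D *v y)"
    using inner_mono_vec[OF y(1) \<pi>(1)] by (simp add: inner_commute)
  also have "\<dots> \<le> p \<bullet> (Amat D *v y)"
    unfolding inner_matrix_vector_transpose by (rule inner_mono_vec[OF \<pi>(2) y(2)])
  finally show ?thesis .
qed

lemma minimax_regret_le_subproblem:
  assumes rcr: "relatively_complete_recourse D" and x: "x \<in> first_stage D"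
  shows "minimax_regret D \<le> ereal (cvec D \<bullet> x) + sp D x"
proof -
  let ?cost = "\<lambda>p xs ys y. cvec D \<bullet> x + p \<bullet> (Amat D *v y) - cvec D \<bullet> xs - p \<bullet> (Amat D *v ys)"
  have "(INF y\<in>second_stage D x. ereal (?cost p xs ys y)) \<le> ereal (cvec D \<bullet> x) + sp D x"
    if m: "(p, xs, ys) \<in> middle_stage D" for p xs ys
  proof (rule ccontr)
    assume "\<not> ?thesis"
    then obtain \<alpha> where \<alpha>: "ereal (cvec D \<bullet> x) + sp D x < ereal \<alpha>"
        "ereal \<alpha> < (INF y\<in>second_stage D x. ereal (?cost p xs ys y))"
      using ereal_dense2 by (meson not_le)
    \<comment> \<open>A strict lower bound of the cost \<open>p \<bullet> (Amat D *v y)\<close> over all second stage decisions.\<close>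
    define \<beta> where "\<beta> = \<alpha> - cvec D \<bullet> x + cvec D \<bullet> xs + p \<bullet> (Amat D *v ys)"
    obtain y0 where "y0 \<in> second_stage D x"
      using rcr x m unfolding relatively_complete_recourse_def by blast
    then have y0: "dvec D - Bmat D *v x \<le> Cmat D *v y0" "0 \<le> y0"
      by (auto simp: second_stage_def less_eq_vec_def algebra_simps)
    have "\<exists>\<pi>. 0 \<le> \<pi> \<and> transpose (Cmat D) *v \<pi> \<le> transpose (Amat D) *v p
        \<and> \<beta> \<le> (dvec D - Bmat D *v x) \<bullet> \<pi>"
    proof (rule lp_dual_certificate[OF y0])
      fix y assume "dvec D - Bmat D *v x \<le> Cmat D *v y" "0 \<le> y"
      then have "y \<in> second_stage D x"
        by (auto simp: second_stage_def less_eq_vec_def algebra_simps)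
      then have "ereal \<alpha> < ereal (?cost p xs ys y)"
        using \<alpha>(2) by (meson INF_lower less_le_trans)
      then show "\<beta> \<le> (transpose (Amat D) *v p) \<bullet> y"
        unfolding inner_matrix_vector_transpose[symmetric] \<beta>_def by simp
    qed
    then obtain \<pi> where \<pi>: "0 \<le> \<pi>" "transpose (Cmat D) *v \<pi> \<le> transpose (Amat D) *v p"
        "\<beta> \<le> (dvec D - Bmat D *v x) \<bullet> \<pi>" by blast
    have "(p, xs, ys, \<pi>) \<in> subproblem_polyhedron D"
      using m \<pi> by (simp add: subproblem_polyhedron_iff)
    then have "ereal (sp_objective D x (p, xs, ys, \<pi>)) \<le> sp D x"
      unfolding sp_def by (rule SUP_upper)
    moreover have "\<alpha> - cvec D \<bullet> x \<le> sp_objective D x (p, xs, ys, \<pi>)"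
      using \<pi>(3) by (simp add: \<beta>_def)
    ultimately have "ereal (\<alpha> - cvec D \<bullet> x) \<le> sp D x"
      by (meson ereal_less_eq(3) order_trans)
    then have "ereal \<alpha> \<le> ereal (cvec D \<bullet> x) + sp D x"
      by (cases "sp D x") auto
    then show False using \<alpha>(1) by simp
  qed
  then have "(SUP (p, xs, ys)\<in>middle_stage D. INF y\<in>second_stage D x. ereal (?cost p xs ys y))
      \<le> ereal (cvec D \<bullet> x) + sp D x"
    by (intro SUP_least) auto
  then show ?thesis unfolding minimax_regret_def using x by (intro INF_lower2)
qed

text \<open>To avoid showing that the second stage minimum is attained, the worst-case regret of \<open>x\<close> is replaced
  by a number \<open>r\<close> such that every middle stage decision has a response of cost below \<open>r\<close>.\<close>

lemma le_minimax_regretI: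
  assumes "\<And>x r. x \<in> first_stage D \<Longrightarrow>
      (\<And>p xs ys. (p, xs, ys) \<in> middle_stage D \<Longrightarrow>
        \<exists>y\<in>second_stage D x. cvec D \<bullet> x + p \<bullet> (Amat D *v y) - cvec D \<bullet> xs - p \<bullet> (Amat D *v ys) < r)
      \<Longrightarrow> z \<le> ereal r"
  shows "z \<le> minimax_regret D"
  unfolding minimax_regret_def
proof (rule INF_greatest)
  fix x assume x: "x \<in> first_stage D"
  let ?cost = "\<lambda>p xs ys y. cvec D \<bullet> x + p \<bullet> (Amat D *v y) - cvec D \<bullet> xs - p \<bullet> (Amat D *v ys)"
  let ?V = "SUP (p, xs, ys)\<in>middle_stage D. INF y\<in>second_stage D x. ereal (?cost p xs ys y)"
  show "z \<le> ?V"
  proof (rule ccontr)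
    assume "\<not> z \<le> ?V"
    then obtain r where r: "?V < ereal r" "ereal r < z" using ereal_dense2 by (meson not_le)
    have "\<exists>y\<in>second_stage D x. ?cost p xs ys y < r" if m: "(p, xs, ys) \<in> middle_stage D" for p xs ys
    proof -
      have "(INF y\<in>second_stage D x. ereal (?cost p xs ys y)) \<le> ?V"
        using m by (intro SUP_upper2[of "(p, xs, ys)"]) auto
      then have "(INF y\<in>second_stage D x. ereal (?cost p xs ys y)) < ereal r" using r(1) by simp
      then show ?thesis unfolding INF_less_iff by simp
    qed
    then have "z \<le> ereal r" by (rule assms[OF x])
    then show False using r(2) by simp
  qed
qed

lemma sp_eq_objective:
  assumes "sp_solution D x v"
  shows "sp D x = ereal (sp_objective D x v)"
  unfolding sp_def
proof (rule antisym)
  show "(SUP w\<in>subproblem_polyhedron D. ereal (sp_objective D x w)) \<le> ereal (sp_objective D x v)"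
    using assms by (intro SUP_least) (simp add: sp_solution_def)
  show "ereal (sp_objective D x v) \<le> (SUP w\<in>subproblem_polyhedron D. ereal (sp_objective D x w))"
    using assms subproblem_vertices_subset by (intro SUP_upper) (auto simp: sp_solution_def)
qed


section \<open>Termination of cutting plane schemes\<close>

text \<open>The common structure of both algorithms: every main problem is a relaxation, and it contains
  the cut of a subproblem solution as soon as it contains an earlier tuple with the same \<open>key\<close>. The
  key is the whole tuple for the dual algorithm, and its first component for C\&CG.\<close>

locale cut_scheme =
  fixes D :: "('nx::finite, 'np::finite, 'ny::finite, 'nd::finite, 'nf::finite, 'nh::finite) problem"
    and mp :: "(nat \<Rightarrow> ('nx, 'np, 'ny, 'nd) tuple) \<Rightarrow> nat \<Rightarrow> real ^ 'nx \<Rightarrow> ereal \<Rightarrow> bool"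
    and key :: "('nx, 'np, 'ny, 'nd) tuple \<Rightarrow> 'key"
  assumes first_stage: "mp v k x \<eta> \<Longrightarrow> x \<in> first_stage D"
    and relaxation: "mp v k x \<eta> \<Longrightarrow> (\<And>l. l \<in> {1..k} \<Longrightarrow> v l \<in> subproblem_polyhedron D) \<Longrightarrow>
      ereal (cvec D \<bullet> x) + \<eta> \<le> minimax_regret D"
    and cut: "mp v k x \<eta> \<Longrightarrow> l \<in> {1..k} \<Longrightarrow> sp_solution D x' (v l) \<Longrightarrow> sp_solution D x w \<Longrightarrow>
      key (v l) = key w \<Longrightarrow> ereal (sp_objective D x w) \<le> \<eta>"
begin

lemma execution_sp_solution:
  assumes "execution D \<epsilon> mp x \<eta> v K" and "l \<in> {1..K}"
  shows "sp_solution D (x (l - 1)) (v l)"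
  using assms(1)[unfolded execution_def, rule_format, of "l - 1"] assms(2) by auto

lemma execution_tuples:
  assumes "execution D \<epsilon> mp x \<eta> v K"
  shows "v ` {1..K} \<subseteq> subproblem_vertices D"
  using execution_sp_solution[OF assms] unfolding sp_solution_def by blast

lemma execution_bounds:
  assumes rcr: "relatively_complete_recourse D" and "execution D \<epsilon> mp x \<eta> v K"
  shows "lower_bound D x \<eta> K \<le> minimax_regret D \<and> minimax_regret D \<le> upper_bound D x K"
  using assms(2)
proof (induction K)
  case 0
  then show ?case by simp
next
  case (Suc K)
  have ex: "execution D \<epsilon> mp x \<eta> v K" and mp: "mp v K (x K) (\<eta> K)"
    using Suc.prems by (auto simp: execution_def)
  have "v l \<in> subproblem_polyhedron D" if "l \<in> {1..K}" for l
    using execution_tuples[OF ex] that subproblem_vertices_subset by blast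
  then have "ereal (cvec D \<bullet> x K) + \<eta> K \<le> minimax_regret D" by (rule relaxation[OF mp])
  moreover have "minimax_regret D \<le> ereal (cvec D \<bullet> x K) + sp D (x K)"
    by (rule minimax_regret_le_subproblem[OF rcr first_stage[OF mp]])
  ultimately show ?case using Suc.IH[OF ex] by simp
qed

text \<open>A repeated key closes the gap at the end of the iteration in which it occurs. The key of the
  last tuple may be a repetition, as the loop condition is not tested after it.\<close>

lemma execution_inj_key:
  assumes eps: "0 \<le> \<epsilon>" and ex: "execution D \<epsilon> mp x \<eta> v K"
  shows "inj_on (\<lambda>l. key (v l)) {1..<K}"
proof (rule linorder_inj_onI')
  fix l j assume lj: "l \<in> {1..<K}" "j \<in> {1..<K}" "l < j"
  show "key (v l) \<noteq> key (v j)"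
  proof
    assume eq: "key (v l) = key (v j)"
    obtain k where j: "j = Suc k" and k: "k < K" "Suc k < K" "l \<in> {1..k}"
      using lj by (cases j) auto
    have mp: "mp v k (x k) (\<eta> k)" and gap: "ereal \<epsilon> < gap D x \<eta> (Suc k)"
      and sol: "sp_solution D (x k) (v (Suc k))"
      using ex k by (auto simp: execution_def)
    have "ereal (sp_objective D (x k) (v (Suc k))) \<le> \<eta> k"
      using cut[OF mp k(3) execution_sp_solution[OF ex] sol] lj eq j by auto
    then have "ereal (cvec D \<bullet> x k) + sp D (x k) \<le> ereal (cvec D \<bullet> x k) + \<eta> k"
      unfolding sp_eq_objective[OF sol] by (rule add_left_mono)
    then have "ereal (cvec D \<bullet> x k + sp_objective D (x k) (v (Suc k))) \<le> lower_bound D x \<eta> (Suc k)"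
      by (simp add: sp_eq_objective[OF sol] max.coboundedI2)
    moreover have "upper_bound D x (Suc k) \<le> ereal (cvec D \<bullet> x k + sp_objective D (x k) (v (Suc k)))"
      by (simp add: sp_eq_objective[OF sol])
    ultimately have "gap D x \<eta> (Suc k) \<le> 0"
      unfolding gap_def
      by (cases "upper_bound D x (Suc k)"; cases "lower_bound D x \<eta> (Suc k)") auto
    also have "0 \<le> ereal \<epsilon>" using eps by simp
    finally show False using gap by simp
  qed
qed

theorem converges:
  assumes eps: "0 \<le> \<epsilon>" and rcr: "relatively_complete_recourse D"
  shows "converges_within D \<epsilon> mp (card (key ` subproblem_vertices D) + 1)"
proof -
  let ?N = "card (key ` subproblem_vertices D) + 1"
  have bound: "K \<le> ?N" if ex: "execution D \<epsilon> mp x \<eta> v K" for x \<eta> v K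
  proof -
    have "(\<lambda>l. key (v l)) ` {1..<K} \<subseteq> key ` subproblem_vertices D"
      using execution_tuples[OF ex] by force
    then have "card {1..<K} \<le> card (key ` subproblem_vertices D)"
      by (intro card_inj_on_le[OF execution_inj_key[OF eps ex]])
        (simp_all add: finite_subproblem_vertices)
    then show ?thesis by simp
  qed
  moreover have "\<exists>K. execution D \<epsilon> mp x \<eta> v K \<and> gap D x \<eta> K \<le> ereal \<epsilon>"
    if run: "algorithm_run D \<epsilon> mp x \<eta> v" for x \<eta> v
  proof (rule ccontr)
    assume no: "\<not> ?thesis"
    have "execution D \<epsilon> mp x \<eta> v K" for K
    proof (induction K)
      case 0
      show ?case by (simp add: execution_def)
    next
      case (Suc K)
      then show ?case using run no unfolding algorithm_run_def by (meson not_le)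
    qed
    then show False using bound[of x \<eta> v "Suc ?N"] by simp
  qed
  ultimately show ?thesis
    unfolding converges_within_def using execution_bounds[OF rcr] by blast
qed

end


section \<open>The two algorithms\<close>

text \<open>For fixed \<open>p\<close> the polyhedron is a product of the feasible sets of \<open>(xs, ys)\<close> and of \<open>\<pi>\<close>, and
  the objective separates accordingly. So the optimal value of the \<open>(xs, ys)\<close>-part depends on \<open>p\<close>
  only, neither on \<open>x\<close> nor on the chosen vertex.\<close>

lemma sp_solution_inner_cost_le:
  assumes "sp_solution D x (p, xs, ys, \<pi>)" and "sp_solution D x' (p, xs', ys', \<pi>')"
  shows "cvec D \<bullet> xs + p \<bullet> (Amat D *v ys) \<le> cvec D \<bullet> xs' + p \<bullet> (Amat D *v ys')"
proof -
  have "(p, xs, ys, \<pi>) \<in> subproblem_polyhedron D" "(p, xs', ys', \<pi>') \<in> subproblem_polyhedron D"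
    using assms subproblem_vertices_subset by (auto simp: sp_solution_def)
  then have "(p, xs', ys', \<pi>) \<in> subproblem_polyhedron D"
    by (simp add: subproblem_polyhedron_iff)
  then have "sp_objective D x (p, xs', ys', \<pi>) \<le> sp_objective D x (p, xs, ys, \<pi>)"
    using assms(1) unfolding sp_solution_def by blast
  then show ?thesis by simp
qed

lemma ccg_constraint_eq:
  assumes "sp_solution D x (p, xs, ys, \<pi>)" and "sp_solution D x' (p, xs', ys', \<pi>')"
  shows "ccg_constraint D (p, xs, ys, \<pi>) = ccg_constraint D (p, xs', ys', \<pi>')"
proof -
  have "cvec D \<bullet> xs + p \<bullet> (Amat D *v ys) = cvec D \<bullet> xs' + p \<bullet> (Amat D *v ys')"
    using sp_solution_inner_cost_le assms by (meson antisym)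
  then show ?thesis by (auto simp: algebra_simps)
qed

lemma ccg_constraint_imp_cut:
  assumes "v \<in> subproblem_polyhedron D" and "(x, r, y) \<in> ccg_constraint D v"
  shows "sp_objective D x v \<le> r"
proof -
  obtain p xs ys \<pi> where v: "v = (p, xs, ys, \<pi>)" by (cases v)
  have "y \<in> second_stage D x" using assms(2) by (simp add: v second_stage_def)
  then show ?thesis using weak_duality[of p xs ys \<pi> D y x] assms by (simp add: v)
qed

text \<open>If every middle stage decision leaves \<open>x\<close> a response of cost below \<open>r\<close>, then \<open>x\<close> with
  \<open>\<eta> = r - cvec D \<bullet> x\<close> satisfies the C\&CG constraint of every tuple, for a suitable \<open>y\<close>, and so, by the
  preceding lemma, its constraint in the dual algorithm. This makes the main problems relaxations.\<close>

lemma ccg_constraint_exists: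
  assumes v: "v \<in> subproblem_polyhedron D"
    and r: "\<And>p xs ys. (p, xs, ys) \<in> middle_stage D \<Longrightarrow>
        \<exists>y\<in>second_stage D x. cvec D \<bullet> x + p \<bullet> (Amat D *v y) - cvec D \<bullet> xs - p \<bullet> (Amat D *v ys) < r"
  shows "\<exists>y. (x, r - cvec D \<bullet> x, y) \<in> ccg_constraint D v"
proof -
  obtain p xs ys \<pi> where v_eq: "v = (p, xs, ys, \<pi>)" by (cases v)
  then have "(p, xs, ys) \<in> middle_stage D" using v by (simp add: subproblem_polyhedron_iff)
  then obtain y where "y \<in> second_stage D x"
      "cvec D \<bullet> x + p \<bullet> (Amat D *v y) - cvec D \<bullet> xs - p \<bullet> (Amat D *v ys) < r"
    using r by blast
  then have "(x, r - cvec D \<bullet> x, y) \<in> ccg_constraint D v" by (simp add: v_eq second_stage_def)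
  then show ?thesis ..
qed

lemma cut_scheme_ccg:
  fixes D :: "('nx::finite, 'np::finite, 'ny::finite, 'nd::finite, 'nf::finite, 'nh::finite) problem"
  shows "cut_scheme D (ccg_main_solution D) fst"
proof
  fix v :: "nat \<Rightarrow> ('nx, 'np, 'ny, 'nd) tuple" and k x \<eta>
  assume mp: "ccg_main_solution D v k x \<eta>"
  then show "x \<in> first_stage D"
    by (auto simp: ccg_main_solution_def ccg_vertex_def ccg_feasible_def split: if_splits)
  show "ereal (cvec D \<bullet> x) + \<eta> \<le> minimax_regret D"
    if S: "\<And>l. l \<in> {1..k} \<Longrightarrow> v l \<in> subproblem_polyhedron D"
  proof (cases "k = 0")
    case True
    then show ?thesis using mp by (simp add: ccg_main_solution_def)
  next
    case False
    then obtain r0 where r0: "\<eta> = ereal r0"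
      and opt: "\<And>x' r' y'. (x', r', y') \<in> ccg_feasible D v k \<Longrightarrow> cvec D \<bullet> x + r0 \<le> cvec D \<bullet> x' + r'"
      using mp by (fastforce simp: ccg_main_solution_def)
    show ?thesis
    proof (rule le_minimax_regretI)
      fix x' r
      assume x': "x' \<in> first_stage D" and r: "\<And>p xs ys. (p, xs, ys) \<in> middle_stage D \<Longrightarrow>
        \<exists>y\<in>second_stage D x'. cvec D \<bullet> x' + p \<bullet> (Amat D *v y) - cvec D \<bullet> xs - p \<bullet> (Amat D *v ys) < r"
      have "\<forall>l\<in>{1..k}. \<exists>y. (x', r - cvec D \<bullet> x', y) \<in> ccg_constraint D (v l)"
        using ccg_constraint_exists[OF S r] by blast
      from bchoice[OF this] obtain y
        where "\<forall>l\<in>{1..k}. (x', r - cvec D \<bullet> x', y l) \<in> ccg_constraint D (v l)" ..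
      then have "(x', r - cvec D \<bullet> x', y) \<in> ccg_feasible D v k"
        using x' by (simp add: ccg_feasible_def)
      then show "ereal (cvec D \<bullet> x) + \<eta> \<le> ereal r" using opt r0 by fastforce
    qed
  qed
  show "ereal (sp_objective D x w) \<le> \<eta>"
    if l: "l \<in> {1..k}" and vl: "sp_solution D x' (v l)" and w: "sp_solution D x w"
      and eq: "fst (v l) = fst w" for l x' w
  proof -
    obtain r y where r: "\<eta> = ereal r" and "(x, r, y) \<in> ccg_feasible D v k"
      using mp l by (auto simp: ccg_main_solution_def ccg_vertex_def)
    then have "(x, r, y l) \<in> ccg_constraint D (v l)" using l by (simp add: ccg_feasible_def)
    also have "ccg_constraint D (v l) = ccg_constraint D w"
      using ccg_constraint_eq vl w eq by (metis prod.collapse)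
    finally have "sp_objective D x w \<le> r"
      using w subproblem_vertices_subset by (intro ccg_constraint_imp_cut) (auto simp: sp_solution_def)
    then show ?thesis by (simp add: r)
  qed
qed

lemma cut_scheme_cg:
  fixes D :: "('nx::finite, 'np::finite, 'ny::finite, 'nd::finite, 'nf::finite, 'nh::finite) problem"
  shows "cut_scheme D (cg_main_solution D) id"
proof
  fix v :: "nat \<Rightarrow> ('nx, 'np, 'ny, 'nd) tuple" and k x \<eta>
  assume mp: "cg_main_solution D v k x \<eta>"
  have feas: "\<exists>r. \<eta> = ereal r \<and> (x, r) \<in> cg_feasible D v k" if "k \<noteq> 0"
    using mp that by (auto simp: cg_main_solution_def extreme_point_of_def)
  show "x \<in> first_stage D"
    using mp feas by (cases "k = 0") (auto simp: cg_main_solution_def cg_feasible_def)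
  show "ereal (cvec D \<bullet> x) + \<eta> \<le> minimax_regret D"
    if S: "\<And>l. l \<in> {1..k} \<Longrightarrow> v l \<in> subproblem_polyhedron D"
  proof (cases "k = 0")
    case True
    then show ?thesis using mp by (simp add: cg_main_solution_def)
  next
    case False
    then obtain r0 where r0: "\<eta> = ereal r0"
      and opt: "\<And>x' r'. (x', r') \<in> cg_feasible D v k \<Longrightarrow> cvec D \<bullet> x + r0 \<le> cvec D \<bullet> x' + r'"
      using mp by (fastforce simp: cg_main_solution_def)
    show ?thesis
    proof (rule le_minimax_regretI)
      fix x' r
      assume x': "x' \<in> first_stage D" and r: "\<And>p xs ys. (p, xs, ys) \<in> middle_stage D \<Longrightarrow>
        \<exists>y\<in>second_stage D x'. cvec D \<bullet> x' + p \<bullet> (Amat D *v y) - cvec D \<bullet> xs - p \<bullet> (Amat D *v ys) < r"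
      have "\<forall>l\<in>{1..k}. sp_objective D x' (v l) \<le> r - cvec D \<bullet> x'"
        using ccg_constraint_exists[OF S r] ccg_constraint_imp_cut[OF S] by blast
      then have "(x', r - cvec D \<bullet> x') \<in> cg_feasible D v k"
        using x' by (simp add: cg_feasible_def)
      then show "ereal (cvec D \<bullet> x) + \<eta> \<le> ereal r" using opt r0 by fastforce
    qed
  qed
  show "ereal (sp_objective D x w) \<le> \<eta>"
    if "l \<in> {1..k}" and "id (v l) = id w" for l w
    using feas that by (auto simp: cg_feasible_def)
qed


section \<open>One value of \<open>p\<close>, exponentially many vertices\<close>

text \<open>The constraints \<open>p \<ge> 1\<close> and \<open>- p \<ge> - 1\<close> (rows \<open>1\<close> and \<open>2\<close> of \<open>Emat\<close>) fix \<open>p = 1\<close>. As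
  \<open>Cmat\<close> is the identity and \<open>Amat\<close> a row of ones, the conditions on \<open>\<pi>\<close> then define the unit cube.
  With \<open>dvec = 1\<close> and \<open>Bmat\<close> the identity, the objective coefficient \<open>1 - x $ i\<close> of \<open>\<pi> $ i\<close> has
  either sign, depending on \<open>x\<close>. The first stage is the nonnegative orthant.\<close>

definition cube_problem :: "('n::finite, 1, 'n, 'n, 2, 'h::finite) problem" where
  "cube_problem = \<lparr>cvec = 0, dvec = 1, fvec = (\<chi> i. if i = 1 then 1 else - 1), hvec = 0,
    Amat = (\<chi> i j. 1), Bmat = mat 1, Cmat = mat 1,
    Emat = (\<chi> i j. if i = 1 then 1 else - 1), Gmat = 0\<rparr>"

lemma cube_first_stage: "first_stage cube_problem = {x. 0 \<le> x}"
  by (simp add: first_stage_def cube_problem_def)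

lemma cube_subproblem_polyhedron:
  "(p, xs, ys, \<pi>) \<in> subproblem_polyhedron (cube_problem :: ('n::finite, 1, 'n, 'n, 2, 'h::finite) problem)
    \<longleftrightarrow> p = 1 \<and> (\<forall>i. 0 \<le> xs $ i \<and> 0 \<le> ys $ i \<and> 1 \<le> xs $ i + ys $ i \<and> 0 \<le> \<pi> $ i \<and> \<pi> $ i \<le> 1)"
proof -
  have "(p = 1) = (p $ 1 = 1)" for p :: "real ^ 1" by (simp add: vec_eq_iff)
  then show ?thesis
    by (auto simp: subproblem_polyhedron_def cube_problem_def less_eq_vec_def transpose_mat
      matrix_vector_mult_def[of "vec_lambda _"] transpose_def[of "vec_lambda _"] forall_2)
qed

lemma cube_recourse: "relatively_complete_recourse cube_problem"
proof -
  have "1 \<in> second_stage cube_problem x" if "x \<in> first_stage cube_problem" for x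
  proof -
    have "0 \<le> x" using that by (simp add: cube_first_stage)
    then show ?thesis by (simp add: second_stage_def cube_problem_def less_eq_vec_def)
  qed
  then show ?thesis unfolding relatively_complete_recourse_def by auto
qed

lemma cube_sp_objective:
  "sp_objective cube_problem x (1, xs, ys, \<pi>) = (\<Sum>i\<in>UNIV. (1 - x $ i) * \<pi> $ i) - (\<Sum>i\<in>UNIV. ys $ i)"
  by (simp add: cube_problem_def inner_vec_def matrix_vector_mult_def[of "vec_lambda _"])

text \<open>A first stage decision for which the optimal vertex of the unit cube is the one with support \<open>T\<close>:
  the objective coefficient of \<open>\<pi> $ i\<close> is \<open>1\<close> for \<open>i \<in> T\<close> and \<open>- 1\<close> otherwise.\<close>

definition cube_decision :: "'n::finite set \<Rightarrow> real ^ 'n" where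
  "cube_decision T = (\<chi> i. if i \<in> T then 0 else 2)"

text \<open>The vertex of the subproblem polyhedron over the vertex of the unit cube with support \<open>T\<close>. As
  \<open>cvec = 0\<close>, the constraint \<open>xs + ys \<ge> 1\<close> is met at no cost by \<open>xs = 1\<close>, \<open>ys = 0\<close>.\<close>

definition cube_tuple :: "'n::finite set \<Rightarrow> ('n, 1, 'n, 'n) tuple" where
  "cube_tuple T = (1, 1, 0, \<chi> i. if i \<in> T then 1 else 0)"

lemma inj_cube_tuple: "inj cube_tuple"
proof (rule injI)
  fix S T :: "'n::finite set" assume "cube_tuple S = cube_tuple T"
  then have "(if i \<in> S then 1 else 0) = (if i \<in> T then 1 else 0 :: real)" for i
    by (simp add: cube_tuple_def vec_eq_iff)
  then show "S = T" by (metis subsetI subset_antisym zero_neq_one)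
qed

lemma cube_tuple_mem: "cube_tuple T \<in> subproblem_polyhedron cube_problem"
  by (simp add: cube_tuple_def cube_subproblem_polyhedron)

lemma convex_combination_at_bound:
  fixes a b u m :: real
  assumes "0 < u" "u < 1" "m \<le> a" "m \<le> b" "(1 - u) * a + u * b = m"
  shows "a = m \<and> b = m"
proof -
  have "(1 - u) * (a - m) + u * (b - m) = 0" using assms(5) by (simp add: algebra_simps)
  moreover have "0 \<le> (1 - u) * (a - m)" "0 \<le> u * (b - m)" using assms by auto
  ultimately have "(1 - u) * (a - m) = 0" "u * (b - m) = 0" by linarith+
  then show ?thesis using assms by auto
qed

lemma cube_tuple_vertex: "cube_tuple T \<in> subproblem_vertices cube_problem"
proof -
  have "a = cube_tuple T \<and> b = cube_tuple T"
    if a: "a \<in> subproblem_polyhedron cube_problem" and b: "b \<in> subproblem_polyhedron cube_problem"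
      and u: "0 < u" "u < 1" and eq: "cube_tuple T = (1 - u) *\<^sub>R a + u *\<^sub>R b" for a b u
  proof -
    obtain p1 xs1 ys1 \<pi>1 p2 xs2 ys2 \<pi>2 where ab: "a = (p1, xs1, ys1, \<pi>1)" "b = (p2, xs2, ys2, \<pi>2)"
      by (cases a; cases b)
    note a' = a[unfolded ab cube_subproblem_polyhedron]
    note b' = b[unfolded ab cube_subproblem_polyhedron]
    have e: "(1 - u) * xs1 $ i + u * xs2 $ i = 1" "(1 - u) * ys1 $ i + u * ys2 $ i = 0"
      "(1 - u) * \<pi>1 $ i + u * \<pi>2 $ i = (if i \<in> T then 1 else 0)" for i
      using eq by (simp_all add: ab cube_tuple_def vec_eq_iff)
    have ys: "ys1 $ i = 0 \<and> ys2 $ i = 0" for i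
      using convex_combination_at_bound[OF u _ _ e(2)] a' b' by blast
    have xs: "xs1 $ i = 1 \<and> xs2 $ i = 1" for i
      using convex_combination_at_bound[OF u _ _ e(1)] a' b' ys by (metis add.right_neutral)
    have \<pi>: "\<pi>1 $ i = (if i \<in> T then 1 else 0) \<and> \<pi>2 $ i = (if i \<in> T then 1 else 0)" for i
    proof (cases "i \<in> T")
      case True
      then have "(1 - u) * (- \<pi>1 $ i) + u * (- \<pi>2 $ i) = - 1" using e(3)[of i] by simp
      then have "- \<pi>1 $ i = - 1 \<and> - \<pi>2 $ i = - 1"
        using a' b' by (intro convex_combination_at_bound[OF u]) auto
      then show ?thesis using True by simp
    next
      case False
      then show ?thesis
        using convex_combination_at_bound[OF u, of 0] e(3)[of i] a' b' by auto
    qed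
    show ?thesis
      using a' b' xs ys \<pi> by (simp add: ab cube_tuple_def vec_eq_iff)
  qed
  then show ?thesis
    unfolding subproblem_vertices_def extreme_point_of_def
    using cube_tuple_mem[of T] by (fastforce simp: in_segment)
qed

lemma cube_tuple_solution: "sp_solution cube_problem (cube_decision T) (cube_tuple T)"
proof -
  have "sp_objective cube_problem (cube_decision T) w
      \<le> sp_objective cube_problem (cube_decision T) (cube_tuple T)"
    if w: "w \<in> subproblem_polyhedron cube_problem" for w
  proof -
    obtain p xs ys \<pi> where weq: "w = (p, xs, ys, \<pi>)" by (cases w)
    note w' = w[unfolded weq cube_subproblem_polyhedron]
    have "(\<Sum>i\<in>UNIV. (1 - cube_decision T $ i) * \<pi> $ i)
        \<le> (\<Sum>i\<in>UNIV. (1 - cube_decision T $ i) * (if i \<in> T then 1 else 0))"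
      using w' by (intro sum_mono) (auto simp: cube_decision_def)
    moreover have "0 \<le> (\<Sum>i\<in>UNIV. ys $ i)" using w' by (intro sum_nonneg) auto
    moreover have "w = (1, xs, ys, \<pi>)" using w' weq by simp
    ultimately show ?thesis by (simp add: cube_tuple_def cube_sp_objective del: sp_objective.simps)
  qed
  then show ?thesis unfolding sp_solution_def using cube_tuple_vertex by blast
qed

lemma cube_vertex_p_values: "vertex_p_values cube_problem = {1}"
proof
  show "vertex_p_values cube_problem \<subseteq> {1}"
    using subproblem_vertices_subset[of cube_problem]
    by (auto simp: vertex_p_values_def cube_subproblem_polyhedron)
  show "{1} \<subseteq> vertex_p_values cube_problem"
    using cube_tuple_vertex[of "{}"] by (force simp: vertex_p_values_eq cube_tuple_def)
qed

text \<open>The only purpose of \<open>D\<close> is to fix the type of \<open>cube_problem\<close>.\<close>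

lemma cube_solutions_card:
  fixes D :: "('n::finite, 1, 'n, 'n, 2, 'h::finite) problem"
  assumes "D = cube_problem"
  shows "2 ^ CARD('n) \<le> card {v. \<exists>x\<in>first_stage D. sp_solution D x v}"
proof -
  let ?V = "{v. \<exists>x\<in>first_stage D. sp_solution D x v}"
  have "0 \<le> cube_decision T" for T :: "'n set" by (simp add: cube_decision_def less_eq_vec_def)
  then have "range cube_tuple \<subseteq> ?V"
    using cube_tuple_solution by (fastforce simp: assms cube_first_stage)
  moreover have "finite ?V"
    by (rule finite_subset[OF _ finite_subproblem_vertices[of D]]) (auto simp: sp_solution_def)
  ultimately have "card (range (cube_tuple :: 'n set \<Rightarrow> _)) \<le> card ?V" by (simp add: card_mono)
  moreover have "card (range (cube_tuple :: 'n set \<Rightarrow> _)) = 2 ^ CARD('n)"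
    by (simp add: card_image[OF inj_cube_tuple] card_UNIV_set)
  ultimately show ?thesis by simp
qed


section \<open>Convergence of both algorithms\<close>

theorem mainTheorem2:
  fixes D :: "('nx::finite, 'np::finite, 'ny::finite, 'nd::finite, 'nf::finite, 'nh::finite) problem"
    and \<epsilon> :: real
  assumes "\<epsilon> \<ge> 0"
    and "relatively_complete_recourse D"
  shows
    "finite (subproblem_vertices D)
     \<and> converges_within D \<epsilon> (ccg_main_solution D) (card (vertex_p_values D) + 1)
     \<and> converges_within D \<epsilon> (cg_main_solution D) (card (subproblem_vertices D) + 1)
     \<and> card (vertex_p_values D) + 1 \<le> card (subproblem_vertices D) + 1
     \<and> (\<forall>x x' p xs ys \<pi> xs' ys' \<pi>'.
          sp_solution D x (p, xs, ys, \<pi>) \<and> sp_solution D x' (p, xs', ys', \<pi>') \<longrightarrow>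
          ccg_constraint D (p, xs, ys, \<pi>) = ccg_constraint D (p, xs', ys', \<pi>'))
     \<and> (\<forall>x \<eta> v K. execution D \<epsilon> (ccg_main_solution D) x \<eta> v K \<longrightarrow>
          (\<lambda>l. fst (v l)) ` {1..<K} \<subseteq> vertex_p_values D \<and> inj_on (\<lambda>l. fst (v l)) {1..<K})
     \<and> (\<exists>D' :: ('nd, 1, 'nd, 'nd, 2, 'nh) problem.
          first_stage D' \<noteq> {} \<and> relatively_complete_recourse D' \<and> card (vertex_p_values D') = 1
          \<and> card {v. \<exists>x\<in>first_stage D'. sp_solution D' x v} \<ge> 2 ^ CARD('nd))"
proof (intro conjI)
  show "finite (subproblem_vertices D)" by (rule finite_subproblem_vertices)
  show "converges_within D \<epsilon> (ccg_main_solution D) (card (vertex_p_values D) + 1)"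
    unfolding vertex_p_values_eq by (rule cut_scheme.converges[OF cut_scheme_ccg assms])
  show "converges_within D \<epsilon> (cg_main_solution D) (card (subproblem_vertices D) + 1)"
    using cut_scheme.converges[OF cut_scheme_cg assms] by simp
  show "card (vertex_p_values D) + 1 \<le> card (subproblem_vertices D) + 1"
    unfolding vertex_p_values_eq by (simp add: card_image_le finite_subproblem_vertices)
  show "\<forall>x x' p xs ys \<pi> xs' ys' \<pi>'.
      sp_solution D x (p, xs, ys, \<pi>) \<and> sp_solution D x' (p, xs', ys', \<pi>') \<longrightarrow>
      ccg_constraint D (p, xs, ys, \<pi>) = ccg_constraint D (p, xs', ys', \<pi>')"
    using ccg_constraint_eq by blast
  show "\<forall>x \<eta> v K. execution D \<epsilon> (ccg_main_solution D) x \<eta> v K \<longrightarrow>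
      (\<lambda>l. fst (v l)) ` {1..<K} \<subseteq> vertex_p_values D \<and> inj_on (\<lambda>l. fst (v l)) {1..<K}"
  proof (intro allI impI conjI)
    fix x \<eta> v K assume ex: "execution D \<epsilon> (ccg_main_solution D) x \<eta> v K"
    show "(\<lambda>l. fst (v l)) ` {1..<K} \<subseteq> vertex_p_values D"
      using cut_scheme.execution_tuples[OF cut_scheme_ccg ex] by (force simp: vertex_p_values_eq)
    show "inj_on (\<lambda>l. fst (v l)) {1..<K}"
      by (rule cut_scheme.execution_inj_key[OF cut_scheme_ccg assms(1) ex])
  qed
  have "first_stage cube_problem \<noteq> {}" by (auto simp: cube_first_stage)
  then show "\<exists>D' :: ('nd, 1, 'nd, 'nd, 2, 'nh) problem.
      first_stage D' \<noteq> {} \<and> relatively_complete_recourse D' \<and> card (vertex_p_values D') = 1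
      \<and> card {v. \<exists>x\<in>first_stage D'. sp_solution D' x v} \<ge> 2 ^ CARD('nd)"
    using cube_solutions_card[where 'n = 'nd and 'h = 'nh, OF refl]
    by (intro exI[of _ cube_problem]) (simp add: cube_recourse cube_vertex_p_values)
qed

end
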